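(* Let $\Lambda\subseteq[0,\infty)$ be an additive semigroup with $0\in\Lambda$, $f$ a holomorphic function on a region $G\subseteq\mathbb C$, and $w$ an admissible weight function on $\Lambda$. If $a\in\mathscr A_w(\Lambda)$ satisfies $\overline{\widetilde a(\mathbb H)}\subseteq G$, then there exists $c\in\mathscr A_w(\Lambda)$ with $f\circ\widetilde a=\widetilde c$ on $\overline{\mathbb H}$.
   Context: $\mathbb H=\{\operatorname{Re}s>0\}$. A weight function is $w\colon\Lambda\to(0,\infty)$, $w(0)=1$, $w(\lambda+\lambda')\le w(\lambda)w(\lambda')$; admissible: $w\ge1$ and $\lim_k w(k\lambda)^{1/k}=1$ for all $\lambda$. $\mathscr A_w(\Lambda)$: $a\colon\Lambda\to\mathbb C$ with $\sum_\lambda|a(\lambda)|w(\lambda)<\infty$, convolution $(a*b)(\lambda)=\sum_{\lambda'+\lambda''=\lambda}a(\lambda')b(\lambda'')$. $\widetilde a(s)=\sum_\lambda a(\lambda)e^{-\lambda s}$ for $s\in\overline{\mathbb H}$. *)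

theory Defs
  imports "HOL-Analysis.Analysis"
begin

definition exp_semigroup :: "real set \<Rightarrow> bool" where
  "exp_semigroup \<Lambda> \<longleftrightarrow> \<Lambda> \<subseteq> {0..} \<and> 0 \<in> \<Lambda> \<and> (\<forall>x\<in>\<Lambda>. \<forall>y\<in>\<Lambda>. x + y \<in> \<Lambda>)"

definition weight_function :: "real set \<Rightarrow> (real \<Rightarrow> real) \<Rightarrow> bool" where
  "weight_function \<Lambda> w \<longleftrightarrow> (\<forall>l\<in>\<Lambda>. w l > 0) \<and> w 0 = 1 \<and>
     (\<forall>l\<in>\<Lambda>. \<forall>l'\<in>\<Lambda>. w (l + l') \<le> w l * w l')"

definition admissible_weight :: "real set \<Rightarrow> (real \<Rightarrow> real) \<Rightarrow> bool" where
  "admissible_weight \<Lambda> w \<longleftrightarrow> weight_function \<Lambda> w \<and> (\<forall>l\<in>\<Lambda>. w l \<ge> 1) \<and>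
     (\<forall>l\<in>\<Lambda>. (\<lambda>k::nat. w (real k * l) powr (1 / real k)) \<longlonglongrightarrow> 1)"

text \<open>The weighted algebra A_w(\<Lambda>): coefficient functions (only values on \<Lambda> matter)
  with \<Sum>_{l\<in>\<Lambda>} |a l| w l < \<infinity>.\<close>
definition Aw :: "real set \<Rightarrow> (real \<Rightarrow> real) \<Rightarrow> (real \<Rightarrow> complex) set" where
  "Aw \<Lambda> w = {a. (\<lambda>l. norm (a l) * w l) summable_on \<Lambda>}"

definition dir_series :: "real set \<Rightarrow> (real \<Rightarrow> complex) \<Rightarrow> complex \<Rightarrow> complex" where
  "dir_series \<Lambda> a s = (\<Sum>\<^sub>\<infinity>l\<in>\<Lambda>. a l * exp (- (of_real l * s)))"

end

theory Submission
  imports Defs "HOL-Complex_Analysis.Complex_Analysis"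
begin

text \<open>
  Identify coefficient functions with their Dirichlet series. Write \<open>a = p + r\<close> with \<open>p\<close> finitely supported and \<open>r\<close> of small weighted norm, and expand
  \<open>f \<circ> a = \<Sum>k. (f\<^sup>(\<^sup>k\<^sup>) \<circ> p) / k! \<cdot> r\<^sup>k\<close>. Cauchy's inequality bounds the sup norm of \<open>(f\<^sup>(\<^sup>k\<^sup>) \<circ> p) / k!\<close> on a
  half plane \<open>Re s > -\<eta>\<close> by \<open>B \<rho>\<^sup>-\<^sup>k\<close>, so it suffices that the weighted norm of \<open>F \<circ> p\<close> is at most a
  constant, independent of \<open>F\<close>, times its sup norm on that half plane. Far to the right \<open>F \<circ> p\<close> is a
  Dirichlet series over the semigroup \<open>S\<close> generated by the frequencies of \<open>p\<close>; shifting a Bohr mean to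
  \<open>Re s = -\<eta>\<close> bounds its \<open>m\<close>-th coefficient by \<open>M exp (-\<eta> m)\<close>, and the sum of \<open>w m exp (-\<eta> m)\<close> over
  \<open>S\<close> is finite because \<open>S\<close> is finitely generated and \<open>w\<close> is admissible.
\<close>

subsection \<open>The weighted algebra\<close>

lemma
  fixes f :: "'a \<Rightarrow> 'c::{real_normed_field,banach}" and g :: "'b \<Rightarrow> 'c"
  assumes f: "(\<lambda>x. norm (f x)) summable_on A" and g: "(\<lambda>y. norm (g y)) summable_on B"
  shows abs_summable_mult_Times: "(\<lambda>z. norm (f (fst z) * g (snd z))) summable_on A \<times> B"
    and infsum_mult_Times: "infsum (\<lambda>z. f (fst z) * g (snd z)) (A \<times> B) = infsum f A * infsum g B"
proof -
  show *: "(\<lambda>z. norm (f (fst z) * g (snd z))) summable_on A \<times> B"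
  proof (rule summable_on_SigmaI)
    show "((\<lambda>y. norm (f (fst (x, y)) * g (snd (x, y)))) has_sum norm (f x) * infsum (\<lambda>y. norm (g y)) B) B"
      for x
      using has_sum_cmult_right[OF has_sum_infsum[OF g], of "norm (f x)"] by (simp add: norm_mult)
    show "(\<lambda>x. norm (f x) * infsum (\<lambda>y. norm (g y)) B) summable_on A"
      by (intro summable_on_cmult_left f)
  qed auto
  have "infsum (\<lambda>z. f (fst z) * g (snd z)) (A \<times> B) = infsum (\<lambda>x. infsum (\<lambda>y. f x * g y) B) A"
    using infsum_Sigma_banach[OF abs_summable_summable[OF *]] by simp
  also have "\<dots> = infsum f A * infsum g B"
    by (simp add: infsum_cmult_right' infsum_cmult_left')
  finally show "infsum (\<lambda>z. f (fst z) * g (snd z)) (A \<times> B) = infsum f A * infsum g B" .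
qed

lemma norm_dirichlet_term: "norm (x * exp (- (of_real l * s))) = norm x * exp (- (l * Re s))"
  by (simp add: norm_mult)

text \<open>Used for two algebras: weight \<open>w\<close> with \<open>\<sigma> = 0\<close> for the
  claim itself, and weight \<open>exp (- (l * \<sigma>))\<close> on a finitely generated semigroup
  for series known to converge only far to the right. The last assumption turns a finite weighted
  norm into absolute convergence on \<open>\<sigma> \<le> Re s\<close>.\<close>

locale weighted_semigroup =
  fixes \<Lambda> :: "real set" and u :: "real \<Rightarrow> real" and \<sigma> :: real
  assumes semigroup: "exp_semigroup \<Lambda>"
    and weight_zero: "u 0 = 1"
    and weight_add: "x \<in> \<Lambda> \<Longrightarrow> y \<in> \<Lambda> \<Longrightarrow> u (x + y) \<le> u x * u y"
    and weight_ge: "x \<in> \<Lambda> \<Longrightarrow> exp (- (x * \<sigma>)) \<le> u x"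
begin

lemma freq_nonneg: "x \<in> \<Lambda> \<Longrightarrow> 0 \<le> x"
  using semigroup unfolding exp_semigroup_def by auto

lemma zero_in: "0 \<in> \<Lambda>" and add_in: "x \<in> \<Lambda> \<Longrightarrow> y \<in> \<Lambda> \<Longrightarrow> x + y \<in> \<Lambda>"
  using semigroup unfolding exp_semigroup_def by auto

lemma weight_pos: "x \<in> \<Lambda> \<Longrightarrow> 0 < u x"
  using weight_ge[of x] exp_gt_zero order_less_le_trans by blast

lemma norm_weight_nonneg: "x \<in> \<Lambda> \<Longrightarrow> 0 \<le> norm c * u x"
  using weight_pos[of x] by simp

lemma norm_term_le:
  assumes "x \<in> \<Lambda>" "\<sigma> \<le> Re s"
  shows "norm (c * exp (- (of_real x * s))) \<le> norm c * u x"
proof -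
  have "exp (- (x * Re s)) \<le> exp (- (x * \<sigma>))"
    using assms freq_nonneg by (simp add: mult_left_mono)
  also have "\<dots> \<le> u x" using weight_ge assms by blast
  finally show ?thesis unfolding norm_dirichlet_term by (simp add: mult_left_mono)
qed

text \<open>Products and series are formed on the level of functions, with some coefficient family
  behind each. \<open>N\<close> is only an upper bound for the weighted norm, so estimates compose
  by monotonicity.\<close>

definition represented :: "(complex \<Rightarrow> complex) \<Rightarrow> real \<Rightarrow> bool" where
  "represented \<phi> N \<longleftrightarrow> (\<exists>c. (\<lambda>l. norm (c l) * u l) summable_on \<Lambda> \<and>
     (\<Sum>\<^sub>\<infinity>l\<in>\<Lambda>. norm (c l) * u l) \<le> N \<and> (\<forall>s. \<sigma> \<le> Re s \<longrightarrow> \<phi> s = dir_series \<Lambda> c s))"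

lemma representedI:
  assumes "(\<lambda>l. norm (c l) * u l) summable_on \<Lambda>" "(\<Sum>\<^sub>\<infinity>l\<in>\<Lambda>. norm (c l) * u l) \<le> N"
    and "\<And>s. \<sigma> \<le> Re s \<Longrightarrow> \<phi> s = dir_series \<Lambda> c s"
  shows "represented \<phi> N"
  using assms unfolding represented_def by blast

lemma representedE:
  assumes "represented \<phi> N"
  obtains c where "(\<lambda>l. norm (c l) * u l) summable_on \<Lambda>" "(\<Sum>\<^sub>\<infinity>l\<in>\<Lambda>. norm (c l) * u l) \<le> N"
    and "\<And>s. \<sigma> \<le> Re s \<Longrightarrow> \<phi> s = dir_series \<Lambda> c s"
  using assms unfolding represented_def by blast

text \<open>Collecting the coefficients with equal frequency; products and series of represented
  functions are the cases where the index set is \<open>\<Lambda> \<times> \<Lambda>\<close> and \<open>UNIV \<times> \<Lambda>\<close>.\<close>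

lemma represented_reindex:
  fixes t :: "'i \<Rightarrow> real" and \<alpha> :: "'i \<Rightarrow> complex"
  assumes t: "\<And>i. i \<in> I \<Longrightarrow> t i \<in> \<Lambda>"
    and summ: "(\<lambda>i. norm (\<alpha> i) * u (t i)) summable_on I"
    and le: "(\<Sum>\<^sub>\<infinity>i\<in>I. norm (\<alpha> i) * u (t i)) \<le> N"
    and \<phi>: "\<And>s. \<sigma> \<le> Re s \<Longrightarrow> \<phi> s = (\<Sum>\<^sub>\<infinity>i\<in>I. \<alpha> i * exp (- (of_real (t i) * s)))"
  shows "represented \<phi> N"
proof -
  \<comment> \<open>Sums over \<open>I\<close> are regrouped over the fibres \<open>A l\<close> of
    \<open>t\<close>; the pairs \<open>(l, i)\<close> with \<open>i \<in> A l\<close> correspond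
    bijectively to \<open>I\<close>.\<close>
  define A where "A l = {i \<in> I. t i = l}" for l
  define c where "c l = infsum \<alpha> (A l)" for l
  have bij: "bij_betw snd (Sigma \<Lambda> A) I"
    unfolding bij_betw_def inj_on_def A_def using t by force
  let ?g = "\<lambda>i. norm (\<alpha> i) * u (t i)"
  have gS: "(\<lambda>(l, i). ?g i) summable_on Sigma \<Lambda> A"
    using summable_on_reindex_bij_betw[OF bij, of ?g] summ by (simp add: case_prod_unfold)
  have gA: "?g summable_on A l" for l
    by (rule summable_on_subset_banach[OF summ]) (auto simp: A_def)
  have nA: "(\<lambda>i. norm (\<alpha> i)) summable_on A l" if "l \<in> \<Lambda>" for l
  proof -
    have "(\<lambda>i. norm (\<alpha> i) * u l) summable_on A l"
      using gA[of l] by (rule summable_on_cong[THEN iffD1, rotated]) (auto simp: A_def)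
    then show ?thesis using weight_pos[OF that] by (simp add: summable_on_cmult_left')
  qed
  have bound: "norm (c l) * u l \<le> infsum ?g (A l)" if "l \<in> \<Lambda>" for l
  proof -
    have "norm (c l) * u l \<le> infsum (\<lambda>i. norm (\<alpha> i)) (A l) * u l"
      unfolding c_def using norm_infsum_bound[OF nA[OF that]] weight_pos[OF that]
      by (simp add: mult_right_mono)
    also have "\<dots> = infsum (\<lambda>i. norm (\<alpha> i) * u l) (A l)" by (simp add: infsum_cmult_left')
    also have "\<dots> = infsum ?g (A l)" by (rule infsum_cong) (auto simp: A_def)
    finally show ?thesis .
  qed
  have gL: "(\<lambda>l. infsum ?g (A l)) summable_on \<Lambda>"
    using summable_on_Sigma_banach[OF gS] by simp
  have gI: "infsum (\<lambda>l. infsum ?g (A l)) \<Lambda> = infsum ?g I"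
    using infsum_Sigma'_banach[OF gS] infsum_reindex_bij_betw[OF bij, of ?g]
    by (simp add: case_prod_unfold)
  have cs: "(\<lambda>l. norm (c l) * u l) summable_on \<Lambda>"
    by (rule summable_on_comparison_test[OF gL bound norm_weight_nonneg])
  show ?thesis
  proof (rule representedI[OF cs])
    show "(\<Sum>\<^sub>\<infinity>l\<in>\<Lambda>. norm (c l) * u l) \<le> N"
      using infsum_mono[OF cs gL bound] gI le by simp
    fix s assume s: "\<sigma> \<le> Re s"
    let ?h = "\<lambda>i. \<alpha> i * exp (- (of_real (t i) * s))"
    have "(\<lambda>i. norm (?h i)) summable_on I"
      by (rule Infinite_Sum.abs_summable_on_comparison_test'[OF summ]) (use norm_term_le t s in blast)
    then have "?h summable_on I" by (rule abs_summable_summable)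
    then have hS: "(\<lambda>(l, i). ?h i) summable_on Sigma \<Lambda> A"
      using summable_on_reindex_bij_betw[OF bij, of ?h] by (simp add: case_prod_unfold)
    have "\<phi> s = infsum ?h I" by (rule \<phi>[OF s])
    also have "\<dots> = infsum (\<lambda>l. infsum ?h (A l)) \<Lambda>"
      using infsum_Sigma'_banach[OF hS] infsum_reindex_bij_betw[OF bij, of ?h]
      by (simp add: case_prod_unfold)
    also have "\<dots> = dir_series \<Lambda> c s"
      unfolding dir_series_def
    proof (rule infsum_cong)
      fix l
      have "infsum ?h (A l) = infsum (\<lambda>i. \<alpha> i * exp (- (of_real l * s))) (A l)"
        by (rule infsum_cong) (auto simp: A_def)
      then show "infsum ?h (A l) = c l * exp (- (of_real l * s))"
        by (simp add: c_def infsum_cmult_left')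
    qed
    finally show "\<phi> s = dir_series \<Lambda> c s" .
  qed
qed

lemma represented_finite_sum:
  assumes "finite F" "F \<subseteq> \<Lambda>"
  shows "represented (\<lambda>s. \<Sum>l\<in>F. b l * exp (- (of_real l * s))) (\<Sum>l\<in>F. norm (b l) * u l)"
  by (rule represented_reindex[where I = F and t = "\<lambda>l. l" and \<alpha> = b]) (use assms in auto)

lemma represented_const: "represented (\<lambda>s. z) (norm z)"
  using represented_finite_sum[of "{0}" "\<lambda>_. z"] zero_in weight_zero by simp

text \<open>Pairs of frequencies index the product; submultiplicativity of \<open>u\<close>
  dominates the weighted double sum by the product of the two norms.\<close>

lemma represented_mult:
  assumes "represented \<phi> M" "represented \<psi> N" "0 \<le> M" "0 \<le> N"
  shows "represented (\<lambda>s. \<phi> s * \<psi> s) (M * N)"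
proof -
  obtain a where a: "(\<lambda>l. norm (a l) * u l) summable_on \<Lambda>"
    "(\<Sum>\<^sub>\<infinity>l\<in>\<Lambda>. norm (a l) * u l) \<le> M" "\<And>s. \<sigma> \<le> Re s \<Longrightarrow> \<phi> s = dir_series \<Lambda> a s"
    using representedE[OF assms(1)] by blast
  obtain b where b: "(\<lambda>l. norm (b l) * u l) summable_on \<Lambda>"
    "(\<Sum>\<^sub>\<infinity>l\<in>\<Lambda>. norm (b l) * u l) \<le> N" "\<And>s. \<sigma> \<le> Re s \<Longrightarrow> \<psi> s = dir_series \<Lambda> b s"
    using representedE[OF assms(2)] by blast
  let ?P = "\<lambda>z. (norm (a (fst z)) * u (fst z)) * (norm (b (snd z)) * u (snd z))"
  let ?t = "\<lambda>z. norm (a (fst z) * b (snd z)) * u (fst z + snd z)"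
  have na: "(\<lambda>l. norm (norm (a l) * u l)) summable_on \<Lambda>"
    using a(1) unfolding summable_on_iff_abs_summable_on_real[of "\<lambda>l. norm (a l) * u l"] .
  have nb: "(\<lambda>l. norm (norm (b l) * u l)) summable_on \<Lambda>"
    using b(1) unfolding summable_on_iff_abs_summable_on_real[of "\<lambda>l. norm (b l) * u l"] .
  have P: "?P summable_on \<Lambda> \<times> \<Lambda>"
    using abs_summable_mult_Times[OF na nb] by (rule abs_summable_summable)
  have tP: "?t z \<le> ?P z" if "z \<in> \<Lambda> \<times> \<Lambda>" for z
    using mult_left_mono[OF weight_add[of "fst z" "snd z"], of "norm (a (fst z) * b (snd z))"] that
    by (auto simp: norm_mult algebra_simps)
  have t0: "0 \<le> ?t z" if "z \<in> \<Lambda> \<times> \<Lambda>" for z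
    using weight_pos[OF add_in[of "fst z" "snd z"]] that by auto
  have T: "?t summable_on \<Lambda> \<times> \<Lambda>"
    by (rule summable_on_comparison_test[OF P tP t0])
  show ?thesis
  proof (rule represented_reindex[OF _ T])
    show "\<And>z. z \<in> \<Lambda> \<times> \<Lambda> \<Longrightarrow> fst z + snd z \<in> \<Lambda>" using add_in by auto
    have "infsum ?t (\<Lambda> \<times> \<Lambda>) \<le> infsum ?P (\<Lambda> \<times> \<Lambda>)" by (rule infsum_mono[OF T P tP])
    also have "\<dots> = (\<Sum>\<^sub>\<infinity>l\<in>\<Lambda>. norm (a l) * u l) * (\<Sum>\<^sub>\<infinity>l\<in>\<Lambda>. norm (b l) * u l)"
      by (rule infsum_mult_Times[OF na nb])
    also have "\<dots> \<le> M * N"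
      using a b assms by (intro mult_mono infsum_nonneg norm_weight_nonneg)
    finally show "infsum ?t (\<Lambda> \<times> \<Lambda>) \<le> M * N" .
    fix s assume s: "\<sigma> \<le> Re s"
    have as: "(\<lambda>l. norm (a l * exp (- (of_real l * s)))) summable_on \<Lambda>"
      by (rule Infinite_Sum.abs_summable_on_comparison_test'[OF a(1)]) (use norm_term_le s in blast)
    have bs: "(\<lambda>l. norm (b l * exp (- (of_real l * s)))) summable_on \<Lambda>"
      by (rule Infinite_Sum.abs_summable_on_comparison_test'[OF b(1)]) (use norm_term_le s in blast)
    show "\<phi> s * \<psi> s = (\<Sum>\<^sub>\<infinity>z\<in>\<Lambda> \<times> \<Lambda>. a (fst z) * b (snd z) * exp (- (of_real (fst z + snd z) * s)))"
      using infsum_mult_Times[OF as bs] a(3)[OF s] b(3)[OF s]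
      by (simp add: dir_series_def algebra_simps exp_add exp_diff exp_minus divide_inverse)
  qed
qed

lemma represented_power:
  assumes "represented \<phi> N" "0 \<le> N"
  shows "represented (\<lambda>s. \<phi> s ^ k) (N ^ k)"
proof (induction k)
  case 0
  show ?case using represented_const[of 1] by simp
next
  case (Suc k)
  show ?case using represented_mult[OF assms(1) Suc] assms(2) by simp
qed

text \<open>Completeness of the algebra: norms bounded by a summable \<open>N\<close> make the
  double family over \<open>UNIV \<times> \<Lambda>\<close> absolutely summable, so the order of
  summation can be exchanged.\<close>

lemma represented_sums:
  assumes rep: "\<And>k. represented (\<phi> k) (N k)" and N: "summable N"
    and sums: "\<And>s. \<sigma> \<le> Re s \<Longrightarrow> (\<lambda>k. \<phi> k s) sums \<psi> s"
  shows "represented \<psi> (suminf N)"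
proof -
  have "\<forall>k. \<exists>c. (\<lambda>l. norm (c l) * u l) summable_on \<Lambda> \<and>
     (\<Sum>\<^sub>\<infinity>l\<in>\<Lambda>. norm (c l) * u l) \<le> N k \<and> (\<forall>s. \<sigma> \<le> Re s \<longrightarrow> \<phi> k s = dir_series \<Lambda> c s)"
    using rep unfolding represented_def by blast
  then obtain c where c: "\<And>k. (\<lambda>l. norm (c k l) * u l) summable_on \<Lambda>"
    "\<And>k. (\<Sum>\<^sub>\<infinity>l\<in>\<Lambda>. norm (c k l) * u l) \<le> N k"
    "\<And>k s. \<sigma> \<le> Re s \<Longrightarrow> \<phi> k s = dir_series \<Lambda> (c k) s"
    by metis
  let ?n = "\<lambda>k. \<Sum>\<^sub>\<infinity>l\<in>\<Lambda>. norm (c k l) * u l"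
  have n0: "0 \<le> ?n k" for k
    by (intro infsum_nonneg norm_weight_nonneg)
  have N0: "0 \<le> N k" for k using n0[of k] c(2)[of k] by linarith
  have NU: "N summable_on UNIV"
    using N summable_on_UNIV_nonneg_real_iff[of N] N0 by blast
  have nU: "?n summable_on UNIV"
    by (rule summable_on_comparison_test[OF NU c(2) n0])
  let ?t = "\<lambda>z. norm (c (fst z) (snd z)) * u (snd z)"
  have T: "?t summable_on (UNIV \<times> \<Lambda>)"
  proof (rule summable_on_SigmaI[OF _ nU])
    show "((\<lambda>l. ?t (k, l)) has_sum ?n k) \<Lambda>" for k
      using has_sum_infsum[OF c(1)] by simp
    show "0 \<le> ?t (k, l)" if "l \<in> \<Lambda>" for k l using weight_pos[OF that] by simp
  qed
  show ?thesis
  proof (rule represented_reindex[OF _ T])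
    have "infsum ?t (UNIV \<times> \<Lambda>) = infsum ?n UNIV"
      using infsum_Sigma_banach[OF T] by simp
    also have "\<dots> \<le> infsum N UNIV" by (rule infsum_mono[OF nU NU c(2)])
    also have "\<dots> = suminf N"
      by (metis NU has_sum_imp_sums has_sum_infsum sums_unique)
    finally show "infsum ?t (UNIV \<times> \<Lambda>) \<le> suminf N" .
    fix s assume s: "\<sigma> \<le> Re s"
    let ?h = "\<lambda>z. c (fst z) (snd z) * exp (- (of_real (snd z) * s))"
    have "(\<lambda>z. norm (?h z)) summable_on UNIV \<times> \<Lambda>"
      by (rule Infinite_Sum.abs_summable_on_comparison_test'[OF T]) (use norm_term_le s in auto)
    then have h: "?h summable_on UNIV \<times> \<Lambda>" by (rule abs_summable_summable)
    have "(\<lambda>k. \<phi> k s) summable_on UNIV"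
      using summable_on_Sigma_banach[of "\<lambda>k l. c k l * exp (- (of_real l * s))" UNIV "\<lambda>_. \<Lambda>"] h c(3)[OF s]
      by (simp add: dir_series_def case_prod_unfold)
    then have "\<psi> s = infsum (\<lambda>k. \<phi> k s) UNIV"
      by (metis has_sum_imp_sums has_sum_infsum sums[OF s] sums_unique2)
    also have "\<dots> = infsum ?h (UNIV \<times> \<Lambda>)"
      using infsum_Sigma_banach[OF h] c(3)[OF s] by (simp add: dir_series_def)
    finally show "\<psi> s = infsum ?h (UNIV \<times> \<Lambda>)" .
  qed auto
qed

end

subsection \<open>Coefficient bound\<close>

text \<open>The prescribed \<open>F0\<close> forces a chosen frequency into the finite part:
  \<open>m\<close> in the coefficient bound, 0 in the splitting of the series of
  \<open>a\<close>.\<close>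

lemma infsum_tail_less:
  fixes f :: "'a \<Rightarrow> real"
  assumes f: "f summable_on S" and nonneg: "\<And>x. x \<in> S \<Longrightarrow> 0 \<le> f x"
    and F0: "finite F0" "F0 \<subseteq> S" and e: "0 < e"
  obtains F where "finite F" "F0 \<subseteq> F" "F \<subseteq> S" "infsum f (S - F) < e"
proof -
  \<comment> \<open>The approximation comes only with \<open>\<le>\<close>, so \<open>e / 2\<close>
    secures the strict bound.\<close>
  obtain F1 where F1: "finite F1" "F1 \<subseteq> S" "dist (sum f F1) (infsum f S) \<le> e / 2"
    using infsum_finite_approximation[OF f, of "e / 2"] e by auto
  let ?F = "F0 \<union> F1"
  have F: "finite ?F" "?F \<subseteq> S" using F0 F1 by auto
  have "infsum f S = infsum f (?F \<union> (S - ?F))" using F by (simp add: Un_absorb1)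
  also have "\<dots> = infsum f ?F + infsum f (S - ?F)"
    by (rule infsum_Un_disjoint) (use F summable_on_subset_banach[OF f, of "S - ?F"] in auto)
  finally have "infsum f S = sum f ?F + infsum f (S - ?F)" using F by simp
  moreover have "sum f F1 \<le> sum f ?F" by (rule sum_mono2) (use F nonneg in auto)
  ultimately have "infsum f (S - ?F) < e" using F1(3) e unfolding dist_real_def by linarith
  with F show ?thesis by (intro that[of ?F]) auto
qed

lemma convex_vertical_strip: "convex {s::complex. a \<le> Re s \<and> Re s \<le> b}"
  using convex_Int[OF convex_halfspace_Re_ge convex_halfspace_Re_le] by (simp add: Int_def)

text \<open>The Bohr mean of \<open>g(s) e\<^sup>m\<^sup>s\<close> over a vertical line isolates \<open>c m\<close> and does not depend on
  the line; both facts are read off a primitive, so that no integral is needed.\<close>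

lemma dirichlet_coeff_bound_aux:
  assumes g: "g holomorphic_on {s. \<alpha> < Re s}" and M: "\<And>s. \<alpha> < Re s \<Longrightarrow> norm (g s) \<le> M"
    and summ: "(\<lambda>l. norm (c l) * exp (- (l * b))) summable_on S"
    and eq: "\<And>s. Re s = b \<Longrightarrow> g s = dir_series S c s"
    and m: "m \<in> S" "0 \<le> m" and ab: "\<alpha> < a" "a < b"
  shows "norm (c m) \<le> M * exp (m * a)"
proof (rule field_le_epsilon)
  fix e :: real assume e: "0 < e"
  let ?P = "{s. \<alpha> < Re s}"
  \<comment> \<open>The factor turns the \<open>m\<close>-th term into the constant
    \<open>c m\<close>; all other terms oscillate along vertical lines.\<close>
  define h where "h s = exp (of_real m * s) * g s" for s
  have M0: "0 \<le> M" using order.trans[OF norm_ge_zero M[of "of_real b"]] ab by simp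
  have "h holomorphic_on ?P" unfolding h_def by (intro holomorphic_intros g)
  then obtain H where "\<And>s. s \<in> ?P \<Longrightarrow> (H has_field_derivative h s) (at s within ?P)"
    using holomorphic_convex_primitive'[OF convex_halfspace_Re_gt open_halfspace_Re_gt] by blast
  then have H: "(H has_field_derivative h s) (at s)" if "\<alpha> < Re s" for s
    using at_within_open[OF _ open_halfspace_Re_gt, of s \<alpha>] that by (metis mem_Collect_eq)
  have normh: "norm (h s) \<le> M * exp (m * Re s)" if "\<alpha> < Re s" for s
    using M[OF that] mult_left_mono[OF M[OF that], of "exp (m * Re s)"]
    by (simp add: h_def norm_mult mult.commute)
  \<comment> \<open>The factor \<open>exp (- (m * b))\<close> compensates the size of
    \<open>exp (of_real m * s)\<close> on the line \<open>Re s = b\<close>.\<close>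
  obtain F where F: "finite F" "{m} \<subseteq> F" "F \<subseteq> S"
    "infsum (\<lambda>l. norm (c l) * exp (- (l * b))) (S - F) < e * exp (- (m * b))"
    using infsum_tail_less[OF summ, of "{m}" "e * exp (- (m * b))"] e m by auto
  \<comment> \<open>A primitive of the finitely many oscillating terms that are kept. It is bounded
    by \<open>K\<close> on \<open>Re s = b\<close>, so its increments stay bounded while those of
    \<open>c m * s\<close> grow with the length of the segment.\<close>
  define Q where "Q s = (\<Sum>l\<in>F - {m}. c l * exp (of_real (m - l) * s) / of_real (m - l))" for s
  define K where "K = (\<Sum>l\<in>F - {m}. norm (c l) * exp ((m - l) * b) / \<bar>m - l\<bar>)"
  have QK: "norm (Q s) \<le> K" if "Re s = b" for s
    unfolding Q_def K_def
    by (rule order.trans[OF norm_sum]) (use that in \<open>auto simp: norm_mult norm_divide simp flip: of_real_diff\<close>)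
  have dQ: "(Q has_field_derivative (\<Sum>l\<in>F - {m}. c l * exp (of_real (m - l) * s))) (at s)" for s
    unfolding Q_def
  proof (rule DERIV_sum)
    fix l assume "l \<in> F - {m}"
    then have "complex_of_real (m - l) \<noteq> 0" by auto
    then show "((\<lambda>s. c l * exp (of_real (m - l) * s) / of_real (m - l)) has_field_derivative
        c l * exp (of_real (m - l) * s)) (at s)"
      by (auto intro!: derivative_eq_intros simp del: of_real_diff)
  qed
  have small: "norm (h s - c m - (\<Sum>l\<in>F - {m}. c l * exp (of_real (m - l) * s))) \<le> e" if s: "Re s = b" for s
  proof -
    let ?t = "\<lambda>l. c l * exp (- (of_real l * s))"
    have nt: "(\<lambda>l. norm (?t l)) summable_on S"
      unfolding norm_dirichlet_term s by (rule summ)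
    then have t: "?t summable_on S" by (rule abs_summable_summable)
    have "dir_series S c s = infsum ?t (F \<union> (S - F))" using F by (simp add: dir_series_def Un_absorb1)
    also have "\<dots> = infsum ?t F + infsum ?t (S - F)"
      by (rule infsum_Un_disjoint) (use F summable_on_subset_banach[OF t, of "S - F"] in auto)
    also have "infsum ?t F = ?t m + (\<Sum>l\<in>F - {m}. ?t l)" using F by (simp add: sum.remove)
    finally have "g s = ?t m + (\<Sum>l\<in>F - {m}. ?t l) + infsum ?t (S - F)" using eq s by simp
    moreover have "exp (of_real m * s) * ?t l = c l * exp (of_real (m - l) * s)" for l
      by (simp add: left_diff_distrib flip: exp_add)
    ultimately have "h s = c m + (\<Sum>l\<in>F - {m}. c l * exp (of_real (m - l) * s)) + exp (of_real m * s) * infsum ?t (S - F)"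
      unfolding h_def by (simp only: distrib_left sum_distrib_left) simp
    then have "norm (h s - c m - (\<Sum>l\<in>F - {m}. c l * exp (of_real (m - l) * s))) = exp (m * b) * norm (infsum ?t (S - F))"
      by (simp add: norm_mult s)
    also have "norm (infsum ?t (S - F)) \<le> infsum (\<lambda>l. norm (?t l)) (S - F)"
      by (rule norm_infsum_bound) (rule summable_on_subset_banach[OF nt], auto)
    also have "\<dots> \<le> e * exp (- (m * b))" unfolding norm_dirichlet_term s using F(4) by simp
    also have "exp (m * b) * (e * exp (- (m * b))) = e" by (simp add: exp_minus)
    finally show ?thesis by simp
  qed
  \<comment> \<open>The increment of \<open>H\<close> along the segment of length
    \<open>2 * T\<close> on \<open>Re s = b\<close> is that along the other three sides of a
    rectangle: two horizontal sides of fixed length, and the segment on \<open>Re s = a\<close>,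
    where \<open>h\<close> is at most \<open>M * exp (m * a)\<close>.\<close>
  have key: "norm (c m) * (2 * T) \<le> 2 * (M * exp (m * b) * (b - a)) + M * exp (m * a) * (2 * T) + 2 * K + e * (2 * T)"
    if T: "0 < T" for T
  proof -
    define x y x0 y0 where "x = Complex b T" and "y = Complex b (- T)" and "x0 = Complex a T" and "y0 = Complex a (- T)"
    have xy: "x - y = Complex 0 (2 * T)" "x0 - y0 = Complex 0 (2 * T)" "x - x0 = Complex (b - a) 0" "y0 - y = Complex (a - b) 0"
      by (auto simp: x_def y_def x0_def y0_def complex_eq_iff)
    have cn: "norm (Complex 0 r) = \<bar>r\<bar>" "norm (Complex r 0) = \<bar>r\<bar>" for r by (auto simp: cmod_def)
    have strip: "norm (H z - H z') \<le> M * exp (m * b) * norm (z - z')"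
      if "a \<le> Re z" "Re z \<le> b" "a \<le> Re z'" "Re z' \<le> b" for z z'
    proof (rule field_differentiable_bound[OF convex_vertical_strip[of a b], where f' = h])
      fix s assume s: "s \<in> {s. a \<le> Re s \<and> Re s \<le> b}"
      show "(H has_field_derivative h s) (at s within {s. a \<le> Re s \<and> Re s \<le> b})"
        using H[of s] s ab by (auto intro: has_field_derivative_at_within)
      have "M * exp (m * Re s) \<le> M * exp (m * b)" using s m M0 by (auto intro!: mult_left_mono)
      then show "norm (h s) \<le> M * exp (m * b)" using normh[of s] s ab by auto
    qed (use that in auto)
    have line: "norm (H x0 - H y0) \<le> M * exp (m * a) * norm (x0 - y0)"
    proof (rule field_differentiable_bound[OF convex_vertical_strip[of a a], where f' = h])
      fix s assume s: "s \<in> {s. a \<le> Re s \<and> Re s \<le> a}"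
      then have "Re s = a" by auto
      then show "(H has_field_derivative h s) (at s within {s. a \<le> Re s \<and> Re s \<le> a})" "norm (h s) \<le> M * exp (m * a)"
        using H[of s] normh[of s] ab by (auto intro: has_field_derivative_at_within)
    qed (auto simp: x0_def y0_def)
    \<comment> \<open>On \<open>Re s = b\<close> the derivative of \<open>D\<close> is
      \<open>exp (of_real m * s)\<close> times the discarded tail, of norm at most
      \<open>e\<close>.\<close>
    define D where "D s = H s - c m * s - Q s" for s
    have D: "norm (D x - D y) \<le> e * norm (x - y)"
    proof (rule field_differentiable_bound[OF convex_vertical_strip[of b b]])
      fix s assume "s \<in> {s. b \<le> Re s \<and> Re s \<le> b}"
      then have s: "Re s = b" by auto
      show "(D has_field_derivative (h s - c m - (\<Sum>l\<in>F - {m}. c l * exp (of_real (m - l) * s))))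
         (at s within {s. b \<le> Re s \<and> Re s \<le> b})"
        unfolding D_def by (rule has_field_derivative_at_within) (rule derivative_eq_intros H dQ | use s ab in simp)+
      show "norm (h s - c m - (\<Sum>l\<in>F - {m}. c l * exp (of_real (m - l) * s))) \<le> e" by (rule small[OF s])
    qed (auto simp: x_def y_def)
    have "c m * (x - y) = (H x - H x0) + (H x0 - H y0) + (H y0 - H y) - Q x + Q y - (D x - D y)"
      by (simp add: D_def algebra_simps)
    also have "norm \<dots> \<le> norm (H x - H x0) + norm (H x0 - H y0) + norm (H y0 - H y) + norm (Q x) + norm (Q y) + norm (D x - D y)"
      by (smt (verit) norm_triangle_ineq norm_triangle_ineq4)
    also have "\<dots> \<le> M * exp (m * b) * norm (x - x0) + M * exp (m * a) * norm (x0 - y0) + M * exp (m * b) * norm (y0 - y) + K + K + e * norm (x - y)"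
      using line D ab QK[of x] QK[of y] by (intro add_mono strip) (auto simp: x_def y_def x0_def y0_def)
    finally show ?thesis using T ab by (simp add: norm_mult xy cn mult_ac add_ac)
  qed
  show "norm (c m) \<le> M * exp (m * a) + e"
  proof (rule ccontr)
    assume "\<not> ?thesis"
    then have d: "0 < norm (c m) - (M * exp (m * a) + e)" (is "0 < ?d") by simp
    define R where "R = M * exp (m * b) * (b - a) + K"
    have "0 \<le> K" unfolding K_def by (intro sum_nonneg) auto
    then have R: "0 \<le> R" using M0 ab by (auto simp: R_def)
    \<comment> \<open>This is \<open>key\<close> halved. The left side is linear in \<open>T\<close>
      and \<open>R\<close> is fixed; the choice \<open>(R + 1) / ?d\<close> would give
      \<open>R + 1 \<le> R\<close>.\<close>
    have "?d * T \<le> R" if "0 < T" for T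
      unfolding R_def using key[OF that] by (simp add: algebra_simps)
    from this[of "(R + 1) / ?d"] show False using d R by simp
  qed
qed

text \<open>The auxiliary bound holds for every \<open>a\<close> between \<open>\<alpha>\<close> and
  \<open>b\<close>; let \<open>a\<close> tend to \<open>\<alpha>\<close>. Absolute convergence is
  asked only on \<open>Re s = b\<close>, so for negative \<open>\<alpha>\<close> mere boundedness of
  \<open>g\<close> further left forces exponential decay of the coefficients.\<close>

lemma dirichlet_coeff_bound:
  assumes "g holomorphic_on {s. \<alpha> < Re s}" "\<And>s. \<alpha> < Re s \<Longrightarrow> norm (g s) \<le> M"
    and "(\<lambda>l. norm (c l) * exp (- (l * b))) summable_on S"
    and "\<And>s. Re s = b \<Longrightarrow> g s = dir_series S c s"
    and "m \<in> S" "0 \<le> m" and "\<alpha> < b"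
  shows "norm (c m) \<le> M * exp (m * \<alpha>)"
proof (rule tendsto_lowerbound)
  show "((\<lambda>a. M * exp (m * a)) \<longlongrightarrow> M * exp (m * \<alpha>)) (at_right \<alpha>)"
    by (intro tendsto_intros)
  show "\<forall>\<^sub>F a in at_right \<alpha>. norm (c m) \<le> M * exp (m * a)"
    using dirichlet_coeff_bound_aux[OF assms(1-6)] assms(7)
    by (auto intro: eventually_at_rightI[of _ b])
qed simp

subsection \<open>Finitely generated semigroups of frequencies\<close>

text \<open>For finite \<open>L\<close> this is the additive monoid generated by \<open>L\<close>;
  \<open>k\<close> lives on all reals, but only its values on \<open>L\<close> count.\<close>

definition nat_span :: "real set \<Rightarrow> real set" where
  "nat_span L = range (\<lambda>k. \<Sum>l\<in>L. real (k l) * l)"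

text \<open>Peels off one generator for inductions over \<open>L\<close>; the image form suits
  comparison with a product family.\<close>

lemma nat_span_insert:
  assumes "finite L" "x \<notin> L"
  shows "nat_span (insert x L) = (\<lambda>z. fst z + real (snd z) * x) ` (nat_span L \<times> UNIV)"
proof (intro equalityI subsetI)
  fix y assume "y \<in> nat_span (insert x L)"
  then obtain k where "y = (\<Sum>l\<in>insert x L. real (k l) * l)" unfolding nat_span_def by auto
  then have "y = (\<Sum>l\<in>L. real (k l) * l) + real (k x) * x" using assms by simp
  then show "y \<in> (\<lambda>z. fst z + real (snd z) * x) ` (nat_span L \<times> UNIV)"
    unfolding nat_span_def by force
next
  fix y assume "y \<in> (\<lambda>z. fst z + real (snd z) * x) ` (nat_span L \<times> UNIV)"
  then obtain k n where "y = (\<Sum>l\<in>L. real (k l) * l) + real n * x" unfolding nat_span_def by auto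
  moreover have "(\<Sum>l\<in>L. real (k l) * l) = (\<Sum>l\<in>L. real ((k(x := n)) l) * l)"
    by (rule sum.cong) (use assms in auto)
  ultimately have "y = (\<Sum>l\<in>insert x L. real ((k(x := n)) l) * l)" using assms by simp
  then show "y \<in> nat_span (insert x L)" unfolding nat_span_def by blast
qed

lemma nat_multiple_in:
  assumes "exp_semigroup \<Lambda>" "x \<in> \<Lambda>"
  shows "real n * x \<in> \<Lambda>"
  using assms by (induction n) (auto simp: exp_semigroup_def algebra_simps)

lemma nat_span_subset:
  assumes "exp_semigroup \<Lambda>" "finite L" "L \<subseteq> \<Lambda>"
  shows "nat_span L \<subseteq> \<Lambda>"
  using assms(2,3)
proof (induction L rule: finite_induct)
  case empty
  then show ?case using assms(1) by (simp add: nat_span_def exp_semigroup_def)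
next
  case (insert x L)
  then show ?case using nat_multiple_in[OF assms(1), of x] assms(1)
    by (auto simp: nat_span_insert exp_semigroup_def)
qed

lemma exp_semigroup_nat_span:
  assumes "L \<subseteq> {0..}"
  shows "exp_semigroup (nat_span L)"
  unfolding exp_semigroup_def
proof (intro conjI ballI subsetI)
  show "x \<in> {0..}" if "x \<in> nat_span L" for x
    using that assms unfolding nat_span_def by (auto intro!: sum_nonneg)
  show "0 \<in> nat_span L" unfolding nat_span_def by (rule range_eqI[of _ _ "\<lambda>_. 0"]) simp
  fix x y assume "x \<in> nat_span L" "y \<in> nat_span L"
  then obtain j k where "x = (\<Sum>l\<in>L. real (j l) * l)" "y = (\<Sum>l\<in>L. real (k l) * l)"
    unfolding nat_span_def by auto
  then have "x + y = (\<Sum>l\<in>L. real (j l + k l) * l)" by (simp add: sum.distrib algebra_simps)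
  then show "x + y \<in> nat_span L"
    unfolding nat_span_def by (intro range_eqI[of _ _ "\<lambda>l. j l + k l"]) simp
qed

lemma subset_nat_span:
  assumes "finite L"
  shows "L \<subseteq> nat_span L"
proof
  fix x assume x: "x \<in> L"
  have "(\<Sum>l\<in>L. real (if l = x then 1 else 0) * l) = (\<Sum>l\<in>L. if l = x then l else 0)"
    by (rule sum.cong) auto
  then have "x = (\<Sum>l\<in>L. real (if l = x then 1 else 0) * l)" using x assms by simp
  then show "x \<in> nat_span L" unfolding nat_span_def by (intro range_eqI[of _ _ "\<lambda>l. if l = x then 1 else 0"]) simp
qed

text \<open>The map \<open>t\<close> may identify indices, as relations between generators do.
  Choosing one preimage per point by \<open>inv_into\<close> reduces the claim to \<open>g\<close>
  on a subset of \<open>I\<close>.\<close>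

lemma summable_on_image_comparison:
  fixes f :: "'b \<Rightarrow> real"
  assumes g: "g summable_on I" and "\<And>i. i \<in> I \<Longrightarrow> 0 \<le> f (t i)" "\<And>i. i \<in> I \<Longrightarrow> f (t i) \<le> g i"
  shows "f summable_on t ` I"
proof (rule summable_on_comparison_test)
  have "inv_into I t ` t ` I \<subseteq> I" by (auto intro: inv_into_into)
  then have "g summable_on inv_into I t ` t ` I" by (rule summable_on_subset_banach[OF g])
  then show "(g \<circ> inv_into I t) summable_on t ` I"
    using summable_on_reindex[of "inv_into I t" "t ` I" g] inj_on_inv_into[of "t ` I" t I] by simp
  show "f y \<le> (g \<circ> inv_into I t) y" if "y \<in> t ` I" for y
    using assms(3)[OF inv_into_into[OF that]] f_inv_into_f[OF that] by simp
  show "0 \<le> f y" if "y \<in> t ` I" for y using that assms(2) by auto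
qed

text \<open>By the root condition \<open>w (real k * x)\<close> is eventually below
  \<open>exp (\<eta> * x / 2) ^ k\<close>: half of the exponential decay absorbs the weight, the
  other half leaves a geometric series.\<close>

lemma summable_weight_multiples:
  assumes adm: "admissible_weight \<Lambda> w" and \<Lambda>: "exp_semigroup \<Lambda>" and x: "x \<in> \<Lambda>" "0 < x" and \<eta>: "0 < \<eta>"
  shows "(\<lambda>k::nat. w (real k * x) * exp (- (\<eta> * (real k * x)))) summable_on UNIV"
proof -
  have w0: "0 < w (real k * x)" for k
    using adm nat_multiple_in[OF \<Lambda> x(1)] unfolding admissible_weight_def weight_function_def by blast
  have lim: "(\<lambda>k::nat. w (real k * x) powr (1 / real k)) \<longlonglongrightarrow> 1"
    using adm x unfolding admissible_weight_def by blast
  have "1 < exp (\<eta> * x / 2)" using x \<eta> by simp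
  then have "\<forall>\<^sub>F k in sequentially. w (real k * x) powr (1 / real k) < exp (\<eta> * x / 2)"
    by (rule order_tendstoD[OF lim])
  then have ev: "\<forall>\<^sub>F k in sequentially. norm (w (real k * x) * exp (- (\<eta> * (real k * x)))) \<le> exp (- (\<eta> * x / 2)) ^ k"
    using eventually_gt_at_top[of 0]
  proof eventually_elim
    case (elim k)
    have "w (real k * x) = (w (real k * x) powr (1 / real k)) powr real k"
      using elim w0[of k] by (simp add: powr_powr)
    also have "\<dots> \<le> exp (\<eta> * x / 2) powr real k"
      using elim by (intro powr_mono2) auto
    also have "\<dots> = exp (real k * (\<eta> * x / 2))" by (simp add: powr_def)
    finally have "w (real k * x) * exp (- (\<eta> * (real k * x))) \<le> exp (real k * (\<eta> * x / 2)) * exp (- (\<eta> * (real k * x)))"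
      by (simp add: mult_right_mono)
    also have "\<dots> = exp (- (\<eta> * x / 2)) ^ k"
      by (simp add: field_simps flip: exp_add exp_of_nat_mult)
    finally show ?case using w0[of k] by simp
  qed
  have "summable (\<lambda>k. w (real k * x) * exp (- (\<eta> * (real k * x))))"
    by (rule summable_comparison_test_ev[OF ev]) (use x \<eta> in \<open>auto intro!: summable_geometric\<close>)
  then show ?thesis
    using w0 by (subst summable_on_UNIV_nonneg_real_iff) (auto simp: less_imp_le)
qed

text \<open>Induction over the generators: submultiplicativity dominates the terms by products of
  terms over the smaller span and over multiples of the new generator. \<open>0 \<notin> L\<close>
  makes that generator positive, as its geometric series requires.\<close>

lemma summable_weight_nat_span:
  assumes adm: "admissible_weight \<Lambda> w" and \<Lambda>: "exp_semigroup \<Lambda>" and \<eta>: "0 < \<eta>"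
    and L: "finite L" "L \<subseteq> \<Lambda>" "0 \<notin> L"
  shows "(\<lambda>m. w m * exp (- (\<eta> * m))) summable_on nat_span L"
  using L
proof (induction L rule: finite_induct)
  case empty
  show ?case by (simp add: nat_span_def)
next
  case (insert x L)
  have w0: "0 < w y" if "y \<in> \<Lambda>" for y
    using adm that unfolding admissible_weight_def weight_function_def by blast
  have x: "x \<in> \<Lambda>" "0 < x" using insert.prems \<Lambda> unfolding exp_semigroup_def
    by (auto simp: order.strict_iff_order)
  have sub: "nat_span L \<subseteq> \<Lambda>" using nat_span_subset[OF \<Lambda>] insert by blast
  let ?f = "\<lambda>m. w m * exp (- (\<eta> * m))"
  let ?h = "\<lambda>k::nat. ?f (real k * x)"
  have L: "(\<lambda>m. norm (?f m)) summable_on nat_span L"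
    using insert summable_on_iff_abs_summable_on_real[of ?f] by auto
  have X: "(\<lambda>k. norm (?h k)) summable_on UNIV"
    using summable_weight_multiples[OF adm \<Lambda> x \<eta>] summable_on_iff_abs_summable_on_real[of ?h] by auto
  have "?f summable_on (\<lambda>z. fst z + real (snd z) * x) ` (nat_span L \<times> UNIV)"
  proof (rule summable_on_image_comparison[OF abs_summable_mult_Times[OF L X]])
    fix z :: "real \<times> nat" assume "z \<in> nat_span L \<times> UNIV"
    then have z: "fst z \<in> \<Lambda>" "real (snd z) * x \<in> \<Lambda>" "fst z + real (snd z) * x \<in> \<Lambda>"
      using sub nat_multiple_in[OF \<Lambda> x(1)] \<Lambda> by (auto simp: exp_semigroup_def)
    show "0 \<le> ?f (fst z + real (snd z) * x)" using w0[OF z(3)] by simp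
    have "w (fst z + real (snd z) * x) \<le> w (fst z) * w (real (snd z) * x)"
      using adm z unfolding admissible_weight_def weight_function_def by blast
    then have "?f (fst z + real (snd z) * x) \<le> (w (fst z) * w (real (snd z) * x)) * exp (- (\<eta> * (fst z + real (snd z) * x)))"
      by (rule mult_right_mono) simp
    also have "\<dots> = ?f (fst z) * ?h (snd z)" 
      by (simp add: distrib_left mult_ac flip: exp_add)
    also have "\<dots> \<le> norm (?f (fst z) * ?h (snd z))" by simp
    finally show "?f (fst z + real (snd z) * x) \<le> norm (?f (fst z) * ?h (snd z))" .
  qed
  then show ?case using insert by (simp add: nat_span_insert)
qed

subsection \<open>Composition with exponential polynomials\<close>

text \<open>As frequencies are nonnegative, the terms on the line \<open>Re s = \<beta>\<close>
  majorise those to its right; the finite sums converge uniformly, and the limit is holomorphic on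
  small discs.\<close>

lemma holomorphic_dir_series:
  assumes summ: "(\<lambda>l. norm (c l) * exp (- (l * \<beta>))) summable_on S" and S: "S \<subseteq> {0..}"
  shows "dir_series S c holomorphic_on {s. \<beta> < Re s}"
proof -
  let ?P = "{s. \<beta> < Re s}"
  have unif: "uniform_limit ?P (\<lambda>F s. \<Sum>l\<in>F. c l * exp (- (of_real l * s))) (dir_series S c) (finite_subsets_at_top S)"
    unfolding dir_series_def
  proof (rule Weierstrass_m_test_general[OF _ summ])
    fix l s assume "l \<in> S" "s \<in> ?P"
    then show "norm (c l * exp (- (of_real l * s))) \<le> norm (c l) * exp (- (l * \<beta>))"
      unfolding norm_dirichlet_term using S by (auto intro!: mult_left_mono)
  qed
  have "dir_series S c field_differentiable (at z)" if z: "z \<in> ?P" for z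
  proof -
    obtain r where r: "0 < r" "cball z r \<subseteq> ?P"
      using z open_contains_cball[of ?P] open_halfspace_Re_gt by blast
    have "dir_series S c holomorphic_on ball z r"
    proof (rule holomorphic_uniform_limit)
      show "uniform_limit (cball z r) (\<lambda>F s. \<Sum>l\<in>F. c l * exp (- (of_real l * s))) (dir_series S c) (finite_subsets_at_top S)"
        using unif r(2) by (rule uniform_limit_on_subset)
      show "\<forall>\<^sub>F F in finite_subsets_at_top S.
        continuous_on (cball z r) (\<lambda>s. \<Sum>l\<in>F. c l * exp (- (of_real l * s))) \<and>
        (\<lambda>s. \<Sum>l\<in>F. c l * exp (- (of_real l * s))) holomorphic_on ball z r"
        by (intro always_eventually allI conjI continuous_intros holomorphic_intros)
    qed auto
    then show ?thesis using r(1) by (simp add: holomorphic_on_imp_differentiable_at)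
  qed
  then show ?thesis by (simp add: holomorphic_on_def field_differentiable_at_within)
qed

lemma weighted_semigroup_admissible:
  assumes "exp_semigroup \<Lambda>" "admissible_weight \<Lambda> w"
  shows "weighted_semigroup \<Lambda> w 0"
  using assms by unfold_locales (auto simp: admissible_weight_def weight_function_def)

text \<open>The weighted norm is here the sum of the absolute values of the terms on
  \<open>Re s = \<sigma>\<close>; this weight is exactly multiplicative.\<close>

lemma weighted_semigroup_exp:
  assumes "exp_semigroup \<Lambda>"
  shows "weighted_semigroup \<Lambda> (\<lambda>l. exp (- (l * \<sigma>))) \<sigma>"
  using assms by unfold_locales (auto simp: algebra_simps simp flip: exp_add)

text \<open>Positive frequencies make each term decay. This locates a line beyond which an
  exponential polynomial stays close to its constant term.\<close>

lemma tendsto_norm_exp_polynomial: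
  fixes b :: "real \<Rightarrow> complex"
  assumes "L \<subseteq> {0<..}"
  shows "((\<lambda>\<sigma>. \<Sum>l\<in>L. norm (b l) * exp (- (l * \<sigma>))) \<longlongrightarrow> 0) at_top"
proof (rule tendsto_null_sum)
  fix l assume "l \<in> L"
  then have "0 < l" using assms by auto
  then have "filterlim (\<lambda>\<sigma>. l * \<sigma>) at_top at_top"
    by (simp add: filterlim_tendsto_pos_mult_at_top[OF tendsto_const] filterlim_ident)
  then have "((\<lambda>\<sigma>. exp (- (l * \<sigma>))) \<longlongrightarrow> 0) at_top"
    by (intro filterlim_compose[OF exp_at_bot] filterlim_compose[OF filterlim_uminus_at_bot_at_top])
  then show "((\<lambda>\<sigma>. norm (b l) * exp (- (l * \<sigma>))) \<longlongrightarrow> 0) at_top"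
    by (rule tendsto_mult_right_zero)
qed

text \<open>Taylor expansion around the value at infinity gives the Dirichlet series of \<open>F \<circ> p\<close> far to
  the right; the coefficient bound then makes it converge, with weights, on the closed half plane.\<close>

lemma represented_comp_exp_polynomial:
  assumes \<Lambda>: "exp_semigroup \<Lambda>" and adm: "admissible_weight \<Lambda> w" and \<eta>: "0 < \<eta>"
    and L: "finite L" "L \<subseteq> \<Lambda>" "0 \<notin> L"
    and U: "open U" "F holomorphic_on U" "z \<in> U"
    and p: "\<And>s. p s = z + (\<Sum>l\<in>L. b l * exp (- (of_real l * s)))"
    and pU: "\<And>s. - \<eta> < Re s \<Longrightarrow> p s \<in> U" and M: "\<And>s. - \<eta> < Re s \<Longrightarrow> norm (F (p s)) \<le> M"
  shows "weighted_semigroup.represented \<Lambda> w 0 (\<lambda>s. F (p s))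
    (M * (\<Sum>\<^sub>\<infinity>m\<in>nat_span L. w m * exp (- (\<eta> * m))))"
proof -
  interpret W: weighted_semigroup \<Lambda> w 0 by (rule weighted_semigroup_admissible[OF \<Lambda> adm])
  define S where "S = nat_span L"
  have L0: "L \<subseteq> {0<..}" using L W.freq_nonneg by (force simp: order.strict_iff_order)
  have "L \<subseteq> {0..}" using L0 by (auto intro: less_imp_le)
  then have S: "exp_semigroup S" "S \<subseteq> \<Lambda>" "L \<subseteq> S"
    using exp_semigroup_nat_span[of L] nat_span_subset[OF \<Lambda> L(1,2)] subset_nat_span[OF L(1)]
    unfolding S_def by blast+
  then have S0: "S \<subseteq> {0..}" unfolding exp_semigroup_def by blast
  have M0: "0 \<le> M" using order.trans[OF norm_ge_zero M[of 0]] \<eta> by simp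
  have wS: "(\<lambda>m. w m * exp (- (\<delta> * m))) summable_on S" if "0 < \<delta>" for \<delta>
    unfolding S_def by (rule summable_weight_nat_span[OF adm \<Lambda> that L])
  have w1: "1 \<le> w m" if "m \<in> S" for m
    using adm S(2) that unfolding admissible_weight_def by auto
  obtain r where r: "0 < r" "ball z r \<subseteq> U" using U open_contains_ball by blast
  \<comment> \<open>The bound \<open>r / 2\<close> instead of \<open>r\<close> leaves room:
    convergence of the Taylor series at distance \<open>r / 2\<close> gives absolute convergence at
    any smaller distance.\<close>
  have "\<forall>\<^sub>F \<sigma> in at_top. (\<Sum>l\<in>L. norm (b l) * exp (- (l * \<sigma>))) < r / 2"
    by (rule order_tendstoD[OF tendsto_norm_exp_polynomial[OF L0]]) (use r in auto)
  then obtain \<sigma> where \<sigma>: "0 < \<sigma>" "(\<Sum>l\<in>L. norm (b l) * exp (- (l * \<sigma>))) < r / 2"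
    using eventually_happens[OF eventually_conj[OF _ eventually_gt_at_top[of 0]]] by auto
  \<comment> \<open>\<open>n\<close> bounds both the weighted norm of \<open>q\<close> and its
    values on \<open>\<sigma> \<le> Re s\<close>, so the Taylor series converges in the algebra and
    pointwise.\<close>
  define n where "n = (\<Sum>l\<in>L. norm (b l) * exp (- (l * \<sigma>)))"
  define q where "q s = (\<Sum>l\<in>L. b l * exp (- (of_real l * s)))" for s
  define T where "T k = (deriv ^^ k) F z / fact k" for k
  have n0: "0 \<le> n" unfolding n_def by (intro sum_nonneg) auto
  have n: "n < r / 2" unfolding n_def by (rule \<sigma>(2))
  interpret V: weighted_semigroup S "\<lambda>l. exp (- (l * \<sigma>))" \<sigma>
    by (rule weighted_semigroup_exp[OF S(1)])
  have power: "(\<lambda>k. T k * x ^ k) sums F (z + x)" if "norm x < r" for x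
    using holomorphic_power_series[OF holomorphic_on_subset[OF U(2) r(2)], of "z + x"] that
    unfolding T_def by (simp add: dist_norm)
  have "V.represented (\<lambda>s. F (p s)) (\<Sum>k. norm (T k) * n ^ k)"
  proof (rule V.represented_sums)
    show "V.represented (\<lambda>s. T k * q s ^ k) (norm (T k) * n ^ k)" for k
    proof (intro V.represented_mult V.represented_power V.represented_const)
      show "V.represented q n"
        unfolding q_def n_def using V.represented_finite_sum[OF L(1) S(3)] by simp
    qed (use n0 in auto)
    have "summable (\<lambda>k. T k * of_real (r / 2) ^ k)"
      using power[of "of_real (r / 2)"] r by (auto simp: sums_iff)
    then have "summable (\<lambda>k. norm (T k * of_real n ^ k))"
      by (rule powser_insidea) (use n0 n r in simp)
    then show "summable (\<lambda>k. norm (T k) * n ^ k)"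
      using n0 by (simp add: norm_mult norm_power)
    fix s assume s: "\<sigma> \<le> Re s"
    have "norm (q s) \<le> n"
      unfolding q_def n_def
    proof (rule sum_norm_le)
      fix l assume "l \<in> L"
      then show "norm (b l * exp (- (of_real l * s))) \<le> norm (b l) * exp (- (l * \<sigma>))"
        using V.norm_term_le[of l s "b l"] S(3) s by auto
    qed
    then show "(\<lambda>k. T k * q s ^ k) sums F (p s)"
      using power[of "q s"] n r(1) unfolding p q_def[symmetric] by simp
  qed
  then obtain c where c: "(\<lambda>l. norm (c l) * exp (- (l * \<sigma>))) summable_on S"
    "\<And>s. \<sigma> \<le> Re s \<Longrightarrow> F (p s) = dir_series S c s"
    using V.representedE by blast
  have hol: "(\<lambda>s. F (p s)) holomorphic_on {s. - \<eta> < Re s}"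
  proof -
    have "p holomorphic_on {s. - \<eta> < Re s}" unfolding p by (intro holomorphic_intros)
    then have "F \<circ> p holomorphic_on {s. - \<eta> < Re s}"
      by (rule holomorphic_on_compose_gen[OF _ U(2)]) (use pU in auto)
    then show ?thesis by (simp add: o_def)
  qed
  \<comment> \<open>The coefficients come from the line \<open>Re s = \<sigma>\<close> far to the
    right, their decay from the boundary \<open>\<alpha> = - \<eta>\<close>.\<close>
  have coeff: "norm (c m) \<le> M * exp (- (\<eta> * m))" if "m \<in> S" for m
    using dirichlet_coeff_bound[OF hol M c(1), of m] c(2) that S0 \<eta> \<sigma> by (auto simp: mult.commute)
  \<comment> \<open>Going left only to \<open>- (\<eta> / 2)\<close> keeps half of the decay for
    summability, and the open half plane reached still contains the imaginary axis. Since
    \<open>w \<ge> 1\<close>, the weight may be inserted.\<close>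
  have "(\<lambda>m. norm (norm (c m) * exp (- (m * - (\<eta> / 2))))) summable_on S"
  proof (rule Infinite_Sum.abs_summable_on_comparison_test'[OF summable_on_cmult_right[OF wS[of "\<eta> / 2"]]])
    fix m assume m: "m \<in> S"
    have "norm (c m) * exp (\<eta> / 2 * m) \<le> M * exp (- (\<eta> * m)) * exp (\<eta> / 2 * m)"
      by (rule mult_right_mono[OF coeff[OF m]]) simp
    also have "\<dots> = M * exp (- (\<eta> / 2 * m))" by (simp add: field_simps flip: exp_add)
    also have "\<dots> \<le> M * (w m * exp (- (\<eta> / 2 * m)))"
      using w1[OF m] M0 by (intro mult_left_mono) auto
    finally show "norm (norm (c m) * exp (- (m * - (\<eta> / 2)))) \<le> M * (w m * exp (- (\<eta> / 2 * m)))"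
      by (simp add: mult.commute)
  qed (use \<eta> in simp)
  then have "(\<lambda>m. norm (c m) * exp (- (m * - (\<eta> / 2)))) summable_on S"
    by simp
  then have hol': "dir_series S c holomorphic_on {s. - (\<eta> / 2) < Re s}"
    using S0 by (rule holomorphic_dir_series)
  \<comment> \<open>Identity theorem: both sides are holomorphic on the connected set
    \<open>- (\<eta> / 2) < Re s\<close> and agree for \<open>\<sigma> < Re s\<close>.\<close>
  have eq: "F (p s) = dir_series S c s" if s: "0 \<le> Re s" for s
  proof (rule analytic_continuation_open[where f = "\<lambda>s. F (p s)" and g = "dir_series S c"
        and s = "{s. \<sigma> < Re s}" and s' = "{s. - (\<eta> / 2) < Re s}"])
    show "{s. \<sigma> < Re s} \<noteq> {}" by (metis (mono_tags) Re_complex_of_real empty_iff gt_ex mem_Collect_eq)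
    show "(\<lambda>s. F (p s)) holomorphic_on {s. - (\<eta> / 2) < Re s}"
      by (rule holomorphic_on_subset[OF hol]) (use \<eta> in auto)
  qed (use hol' c(2) \<eta> \<sigma>(1) s in \<open>auto simp: open_halfspace_Re_gt convex_connected convex_halfspace_Re_gt\<close>)
  have le: "norm (c m) * w m \<le> M * (w m * exp (- (\<eta> * m)))" if "m \<in> S" for m
    using mult_right_mono[OF coeff[OF that], of "w m"] w1[OF that] by (simp add: mult_ac)
  have Mw: "(\<lambda>m. M * (w m * exp (- (\<eta> * m)))) summable_on S"
    by (intro summable_on_cmult_right wS \<eta>)
  have cw: "(\<lambda>m. norm (c m) * w m) summable_on S"
    by (rule summable_on_comparison_test[OF Mw le]) (use W.norm_weight_nonneg S(2) in blast)+
  show ?thesis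
  proof (rule W.represented_reindex[where I = S and t = "\<lambda>m. m" and \<alpha> = c, OF _ cw])
    have "infsum (\<lambda>m. norm (c m) * w m) S \<le> infsum (\<lambda>m. M * (w m * exp (- (\<eta> * m)))) S"
      by (rule infsum_mono[OF cw Mw le])
    then show "infsum (\<lambda>m. norm (c m) * w m) S \<le> M * (\<Sum>\<^sub>\<infinity>m\<in>nat_span L. w m * exp (- (\<eta> * m)))"
      by (simp add: infsum_cmult_right' S_def)
  qed (use S(2) eq in \<open>auto simp: dir_series_def\<close>)
qed

section \<open>Composition with an arbitrary element of the algebra\<close>

theorem theorem3:
  fixes \<Lambda> :: "real set" and w :: "real \<Rightarrow> real" and f :: "complex \<Rightarrow> complex"
    and G :: "complex set" and a :: "real \<Rightarrow> complex"
  assumes "exp_semigroup \<Lambda>"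
    and "open G" and "connected G" and "f holomorphic_on G"
    and "admissible_weight \<Lambda> w"
    and "a \<in> Aw \<Lambda> w"
    and "closure (dir_series \<Lambda> a ` {s. Re s > 0}) \<subseteq> G"
  shows "\<exists>c \<in> Aw \<Lambda> w. \<forall>s. Re s \<ge> 0 \<longrightarrow> f (dir_series \<Lambda> a s) = dir_series \<Lambda> c s"
proof -
  interpret W: weighted_semigroup \<Lambda> w 0 by (rule weighted_semigroup_admissible[OF assms(1,5)])
  note G = assms(2) and f = assms(4)
  have summ: "(\<lambda>l. norm (a l) * w l) summable_on \<Lambda>" using assms(6) by (simp add: Aw_def)
  let ?t = "\<lambda>s l. a l * exp (- (of_real l * s))"
  have nt: "(\<lambda>l. norm (?t s l)) summable_on \<Lambda>" if "0 \<le> Re s" for s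
    by (rule Infinite_Sum.abs_summable_on_comparison_test'[OF summ]) (use W.norm_term_le that in blast)

  \<comment> \<open>The weighted norm of \<open>a\<close> bounds its series, so \<open>K\<close> is
    compact and some closed \<open>e\<close>-neighbourhood of it lies in \<open>G\<close>.\<close>
  define K where "K = closure (dir_series \<Lambda> a ` {s. Re s > 0})"
  have "norm (dir_series \<Lambda> a s) \<le> (\<Sum>\<^sub>\<infinity>l\<in>\<Lambda>. norm (a l) * w l)" if "0 \<le> Re s" for s
    unfolding dir_series_def
    by (rule order.trans[OF norm_infsum_bound[OF nt[OF that]] infsum_mono[OF nt[OF that] summ]])
      (use W.norm_term_le that in blast)
  then have "bounded (dir_series \<Lambda> a ` {s. Re s > 0})" unfolding bounded_iff
    by (intro exI[of _ "\<Sum>\<^sub>\<infinity>l\<in>\<Lambda>. norm (a l) * w l"]) auto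
  then have K: "compact K" unfolding K_def by simp
  obtain e where e: "0 < e" "(\<Union>x\<in>K. cball x e) \<subseteq> G"
    using compact_subset_open_imp_cball_epsilon_subset[OF K G] assms(7) unfolding K_def by blast
  \<comment> \<open>Radius budget: \<open>p s\<close> will lie within \<open>2 * \<rho>\<close> of
    \<open>K\<close>, and a Cauchy disc of radius \<open>\<rho>\<close> around it then stays within
    \<open>3 * \<rho> < e\<close>. The compact set \<open>K'\<close> contains all these discs, so
    one bound \<open>B\<close> serves them all.\<close>
  define \<rho> where "\<rho> = e / 4"
  have \<rho>: "0 < \<rho>" using e by (simp add: \<rho>_def)
  define K' where "K' = {x + y | x y. x \<in> K \<and> y \<in> cball 0 (3 * \<rho>)}"
  have K'I: "y \<in> K'" if "x \<in> K" "dist x y \<le> 3 * \<rho>" for x y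
  proof -
    have "y = x + (y - x)" "y - x \<in> cball 0 (3 * \<rho>)" using that by (auto simp: dist_norm norm_minus_commute)
    then show ?thesis unfolding K'_def using that(1) by blast
  qed
  have K'G: "K' \<subseteq> G"
  proof
    fix z assume "z \<in> K'"
    then obtain x y where "x \<in> K" "norm y \<le> 3 * \<rho>" "z = x + y" unfolding K'_def by auto
    then have "x \<in> K" "z \<in> cball x e" using \<rho> by (auto simp: dist_norm \<rho>_def)
    then show "z \<in> G" using e(2) by blast
  qed
  have "compact K'" unfolding K'_def by (intro compact_sums K compact_cball)
  then have "bounded (f ` K')"
    using f K'G holomorphic_on_imp_continuous_on holomorphic_on_subset
    by (blast intro: compact_imp_bounded compact_continuous_image)
  then obtain B where B: "0 < B" "\<And>z. z \<in> K' \<Longrightarrow> norm (f z) \<le> B" unfolding bounded_pos by blast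

  \<comment> \<open>Including 0 puts the constant term into \<open>p\<close>; a tail below half the
    Cauchy radius yields the ratio 1/2 in the final series.\<close>
  obtain F where F: "finite F" "{0} \<subseteq> F" "F \<subseteq> \<Lambda>" "infsum (\<lambda>l. norm (a l) * w l) (\<Lambda> - F) < \<rho> / 2"
    using infsum_tail_less[OF summ W.norm_weight_nonneg, of "{0}" "\<rho> / 2"] W.zero_in \<rho> by auto
  define L where "L = F - {0}"
  have L: "finite L" "L \<subseteq> \<Lambda>" "0 \<notin> L" using F by (auto simp: L_def)
  have L0: "L \<subseteq> {0<..}" using L W.freq_nonneg by (force simp: order.strict_iff_order)
  define p where "p s = a 0 + sum (?t s) L" for s
  define r where "r s = infsum (?t s) (\<Lambda> - F)" for s
  have sF: "(\<lambda>l. norm (a l) * w l) summable_on \<Lambda> - F"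
    by (rule summable_on_subset_banach[OF summ]) auto
  have split: "dir_series \<Lambda> a s = p s + r s" if s: "0 \<le> Re s" for s
  proof -
    have "dir_series \<Lambda> a s = infsum (?t s) (F \<union> (\<Lambda> - F))"
      using F by (simp add: dir_series_def Un_absorb1)
    also have "\<dots> = infsum (?t s) F + r s"
      unfolding r_def by (rule infsum_Un_disjoint)
        (use F summable_on_subset_banach[OF abs_summable_summable[OF nt[OF s]], of "\<Lambda> - F"] in auto)
    also have "infsum (?t s) F = p s"
      using F by (simp add: p_def L_def sum.remove)
    finally show ?thesis .
  qed
  have r: "norm (r s) \<le> \<rho> / 2" if s: "0 \<le> Re s" for s
  proof -
    have n: "(\<lambda>l. norm (?t s l)) summable_on \<Lambda> - F"
      by (rule summable_on_subset_banach[OF nt[OF s]]) auto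
    have "norm (r s) \<le> infsum (\<lambda>l. norm (?t s l)) (\<Lambda> - F)"
      unfolding r_def by (rule norm_infsum_bound[OF n])
    also have "\<dots> \<le> infsum (\<lambda>l. norm (a l) * w l) (\<Lambda> - F)"
      by (rule infsum_mono[OF n sF]) (use W.norm_term_le s in blast)
    finally show ?thesis using F(4) by simp
  qed
  \<comment> \<open>The same tail bounds the weighted norm of \<open>r\<close>, not merely its
    values.\<close>
  have rep_r: "W.represented r (\<rho> / 2)"
    by (rule W.represented_reindex[where t = "\<lambda>l. l" and \<alpha> = a, OF _ sF])
      (use F(4) in \<open>auto simp: r_def\<close>)
  have aK: "dir_series \<Lambda> a s \<in> K" if "0 < Re s" for s
    unfolding K_def using that by (intro subsetD[OF closure_subset]) auto
  have near: "dist (dir_series \<Lambda> a s) (p s) \<le> \<rho> / 2" if "0 < Re s" for s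
    using split[of s] r[of s] that by (simp add: dist_norm)

  \<comment> \<open>The series of \<open>a\<close> is controlled only for
    \<open>0 \<le> Re s\<close>, so \<open>p\<close> on \<open>- \<eta> < Re s\<close> is compared
    with its translate by \<open>2 * \<eta>\<close> to the right. This sum bounds the displacement;
    as \<open>L\<close> is finite, it tends to 0 with \<open>\<eta>\<close>.\<close>
  have "((\<lambda>\<eta>. \<Sum>l\<in>L. norm (a l) * (exp (l * \<eta>) - exp (- (l * \<eta>)))) \<longlongrightarrow>
      (\<Sum>l\<in>L. norm (a l) * (exp (l * 0) - exp (- (l * 0))))) (at_right 0)"
    by (intro tendsto_intros)
  then have "\<forall>\<^sub>F \<eta> in at_right 0. (\<Sum>l\<in>L. norm (a l) * (exp (l * \<eta>) - exp (- (l * \<eta>)))) < \<rho>"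
    by (rule order_tendstoD) (use \<rho> in simp)
  then obtain \<eta> where \<eta>: "0 < \<eta>" "(\<Sum>l\<in>L. norm (a l) * (exp (l * \<eta>) - exp (- (l * \<eta>)))) < \<rho>"
    using eventually_happens[OF eventually_conj[OF _ eventually_at_right_less[of "0::real"]]]
    by (auto simp: trivial_limit_at_right_real)
  have shift: "dist (p (s + of_real (2 * \<eta>))) (p s) \<le> \<rho>" if s: "- \<eta> < Re s" for s
  proof -
    have "norm (p s - p (s + of_real (2 * \<eta>))) = norm (\<Sum>l\<in>L. ?t s l - ?t (s + of_real (2 * \<eta>)) l)"
      by (simp add: p_def sum_subtractf)
    also have "\<dots> \<le> (\<Sum>l\<in>L. norm (a l) * (exp (l * \<eta>) - exp (- (l * \<eta>))))"
    proof (rule sum_norm_le)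
      fix l assume "l \<in> L"
      then have l: "0 < l" using L0 by auto
      have "?t s l - ?t (s + of_real (2 * \<eta>)) l = ?t s l * of_real (1 - exp (- (2 * l * \<eta>)))"
        by (simp add: algebra_simps exp_of_real[symmetric] flip: exp_add)
      then have "norm (?t s l - ?t (s + of_real (2 * \<eta>)) l) = norm (a l) * exp (- (l * Re s)) * (1 - exp (- (2 * l * \<eta>)))"
        using l \<eta> by (simp only: norm_mult[of "?t s l"] norm_dirichlet_term norm_of_real) simp
      also have "\<dots> \<le> norm (a l) * exp (l * \<eta>) * (1 - exp (- (2 * l * \<eta>)))"
      proof -
        have "l * (- \<eta>) \<le> l * Re s" using l s by (intro mult_left_mono) auto
        then have "exp (- (l * Re s)) \<le> exp (l * \<eta>)" by simp
        then show ?thesis using l \<eta> by (intro mult_right_mono mult_left_mono) auto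
      qed
      also have "\<dots> = norm (a l) * (exp (l * \<eta>) - exp (- (l * \<eta>)))"
        by (simp add: right_diff_distrib mult.assoc flip: exp_add)
      finally show "norm (?t s l - ?t (s + of_real (2 * \<eta>)) l) \<le> norm (a l) * (exp (l * \<eta>) - exp (- (l * \<eta>)))" .
    qed
    finally show ?thesis using \<eta>(2) by (simp add: dist_norm norm_minus_commute)
  qed
  \<comment> \<open>The distance is at most \<open>\<rho> / 2\<close> from the remainder at the
    shifted point plus \<open>\<rho>\<close> from the shift.\<close>
  have close: "\<exists>x\<in>K. dist x (p s) \<le> 2 * \<rho>" if s: "- \<eta> < Re s" for s
  proof
    let ?s = "s + of_real (2 * \<eta>)"
    have "0 < Re ?s" using s \<eta> by simp
    then show "dir_series \<Lambda> a ?s \<in> K" "dist (dir_series \<Lambda> a ?s) (p s) \<le> 2 * \<rho>"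
      using aK near[of ?s] shift[OF s] \<rho> dist_triangle[of "dir_series \<Lambda> a ?s" "p s" "p ?s"] by auto
  qed
  have cball_p: "cball (p s) \<rho> \<subseteq> K'" if s: "- \<eta> < Re s" for s
  proof
    fix y assume "y \<in> cball (p s) \<rho>"
    moreover obtain x where "x \<in> K" "dist x (p s) \<le> 2 * \<rho>" using close[OF s] by blast
    ultimately show "y \<in> K'" using K'I[of x y] dist_triangle[of x y "p s"] by auto
  qed
  \<comment> \<open>\<open>a 0\<close> is the limit of \<open>p\<close> far to the right, hence
    within \<open>\<rho>\<close> of some \<open>p s\<close>. It becomes the centre \<open>z\<close>
    in \<open>represented_comp_exp_polynomial\<close>.\<close>
  have a0: "a 0 \<in> G"
  proof -
    have "\<forall>\<^sub>F \<sigma> in at_top. (\<Sum>l\<in>L. norm (a l) * exp (- (l * \<sigma>))) < \<rho>"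
      by (rule order_tendstoD(2)[OF tendsto_norm_exp_polynomial[OF L0] \<rho>])
    then obtain \<sigma> where \<sigma>: "0 < \<sigma>" "(\<Sum>l\<in>L. norm (a l) * exp (- (l * \<sigma>))) < \<rho>"
      using eventually_happens[OF eventually_conj[OF _ eventually_gt_at_top[of 0]]] by auto
    have "norm (sum (?t (of_real \<sigma>)) L) \<le> (\<Sum>l\<in>L. norm (a l) * exp (- (l * \<sigma>)))"
      by (rule sum_norm_le) (simp add: norm_mult)
    then have "a 0 \<in> cball (p (of_real \<sigma>)) \<rho>"
      using \<sigma> by (simp add: p_def dist_norm)
    then show ?thesis using cball_p[of "of_real \<sigma>"] K'G \<sigma> \<eta> by auto
  qed

  define T where "T k z = (deriv ^^ k) f z / fact k" for k z
  \<comment> \<open>This constant does not depend on \<open>k\<close>; that uniformity makes the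
    series over \<open>k\<close> converge.\<close>
  define C where "C = (\<Sum>\<^sub>\<infinity>m\<in>nat_span L. w m * exp (- (\<eta> * m)))"
  have "nat_span L \<subseteq> \<Lambda>" by (rule nat_span_subset[OF assms(1) L(1,2)])
  then have C: "0 \<le> C"
    unfolding C_def using W.weight_pos by (intro infsum_nonneg mult_nonneg_nonneg) (auto intro: less_imp_le)
  have Tp: "norm (T k (p s)) \<le> B / \<rho> ^ k" if s: "- \<eta> < Re s" for k s
  proof -
    have hol: "f holomorphic_on cball (p s) \<rho>"
      using f cball_p[OF s] K'G holomorphic_on_subset by blast
    have "norm ((deriv ^^ k) f (p s)) \<le> fact k * B / \<rho> ^ k"
    proof (rule Cauchy_inequality[OF _ _ \<rho>])
      show "f holomorphic_on ball (p s) \<rho>" using hol ball_subset_cball holomorphic_on_subset by blast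
      show "continuous_on (cball (p s) \<rho>) f" by (rule holomorphic_on_imp_continuous_on[OF hol])
      show "norm (f x) \<le> B" if "norm (p s - x) = \<rho>" for x
        using that cball_p[OF s] by (intro B(2)) (auto simp: dist_norm)
    qed
    then show ?thesis by (simp add: T_def norm_divide field_simps)
  qed
  have "W.represented (\<lambda>s. f (dir_series \<Lambda> a s)) (\<Sum>k. (B / \<rho> ^ k * C) * (\<rho> / 2) ^ k)"
  proof (rule W.represented_sums)
    fix k
    have "W.represented (\<lambda>s. T k (p s)) (B / \<rho> ^ k * C)"
      unfolding C_def
    proof (rule represented_comp_exp_polynomial[where F = "T k", OF assms(1,5) \<eta>(1) L G _ a0 p_def])
      show "T k holomorphic_on G"
        unfolding T_def by (intro holomorphic_intros holomorphic_higher_deriv f G) auto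
      show "p s \<in> G" if "- \<eta> < Re s" for s
        using cball_p[OF that] K'G \<rho> by (meson centre_in_cball less_imp_le subsetD)
      show "norm (T k (p s)) \<le> B / \<rho> ^ k" if "- \<eta> < Re s" for s by (rule Tp[OF that])
    qed
    then show "W.represented (\<lambda>s. T k (p s) * r s ^ k) ((B / \<rho> ^ k * C) * (\<rho> / 2) ^ k)"
      using B \<rho> C by (intro W.represented_mult W.represented_power rep_r) auto
  next
    have "(B / \<rho> ^ k * C) * (\<rho> / 2) ^ k = B * C * (1 / 2) ^ k" for k
      using \<rho> by (simp add: power_divide)
    then show "summable (\<lambda>k. (B / \<rho> ^ k * C) * (\<rho> / 2) ^ k)"
      by (simp add: summable_geometric summable_mult)
  next
    fix s :: complex assume s: "0 \<le> Re s"
    \<comment> \<open>As the discs lie in \<open>G\<close> for all \<open>- \<eta> < Re s\<close>,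
      the expansion about \<open>p s\<close> also holds on the boundary line
      \<open>Re s = 0\<close>.\<close>
    have "f holomorphic_on ball (p s) \<rho>"
      using f cball_p[of s] K'G s \<eta> ball_subset_cball holomorphic_on_subset
      by (meson less_le_trans neg_less_0_iff_less order_trans)
    moreover have "p s + r s \<in> ball (p s) \<rho>" using r[OF s] \<rho> by (simp add: dist_norm)
    ultimately show "(\<lambda>k. T k (p s) * r s ^ k) sums f (dir_series \<Lambda> a s)"
      using holomorphic_power_series[of f "p s" \<rho> "p s + r s"] split[OF s] by (simp add: T_def)
  qed
  then show ?thesis
    using W.representedE unfolding Aw_def by blast
qed

end
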